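(* Let $n$ be any positive integer and let $\lambda$ be any infinite cardinal. Let $\tau$ be a $T_1$-topology on $\mathscr{I}_\lambda^{n}$ such that $(\mathscr{I}_\lambda^{n},\tau)$ is a semitopological semigroup. Then the following conditions are equivalent: (i) $(\mathscr{I}_\lambda^{n},\tau)$ is compact; (ii) $(\mathscr{I}_\lambda^{n},\tau)$ is $\omega$-bounded-pracompact; (iii) $(\mathscr{I}_\lambda^{n},\tau)$ is feebly $\omega$-bounded.
   Context: For a nonzero cardinal $\lambda$, $\mathscr{I}_\lambda$ is the semigroup of all partial one-to-one transformations of $\lambda$ (injective maps from a subset $\operatorname{dom}\alpha\subseteq\lambda$ into $\lambda$, including the empty map $\boldsymbol{0}$), with operation given by composition of partial maps: $x(\alpha\beta)=(x\alpha)\beta$ for $x\in\operatorname{dom}(\alpha\beta)=\{y\in\operatorname{dom}\alpha : y\alpha\in\operatorname{dom}\beta\}$. The rank of $\alpha$ is $\operatorname{rank}\alpha=|\operatorname{dom}\alpha|$, and $\mathscr{I}_\lambda^n=\{\alpha\in\mathscr{I}_\lambda : \operatorname{rank}\alpha\leqslant n\}$, a subsemigroup of $\mathscr{I}_\lambda$. A semitopological semigroup is a semigroup with a topology for which the semigroup operation is separately continuous (all left and right translations are continuous). A topological space $X$ is: - compact if each open cover of $X$ has a finite subcover (no separation axiom is included); - $\omega$-bounded-pracompact if $X$ contains a dense subset $D$ such that each countable subset of $D$ has compact closure in $X$; - feebly $\omega$-bounded if for each sequence $\{U_k\}_{k\in\mathbb{N}}$ of nonempty open subsets of $X$ there is a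 compact subset $K$ of $X$ such that $K\cap U_k\neq\varnothing$ for each $k$. *)

theory Defs
  imports "HOL-Analysis.Analysis"
begin

definition partial_injections :: "'a set \<Rightarrow> ('a \<rightharpoonup> 'a) set" where
  "partial_injections \<Lambda> = {\<alpha>. dom \<alpha> \<subseteq> \<Lambda> \<and> ran \<alpha> \<subseteq> \<Lambda> \<and> inj_on \<alpha> (dom \<alpha>)}"

(* Finiteness is explicit because card is 0 on infinite sets. *)
definition partial_injections_rank_le :: "'a set \<Rightarrow> nat \<Rightarrow> ('a \<rightharpoonup> 'a) set" where
  "partial_injections_rank_le \<Lambda> n =
     {\<alpha> \<in> partial_injections \<Lambda>. finite (dom \<alpha>) \<and> card (dom \<alpha>) \<le> n}"

(* Maps act on the right, x(\<alpha>\<beta>) = (x\<alpha>)\<beta>, so \<alpha> is applied first. *)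
definition pmult :: "('a \<rightharpoonup> 'a) \<Rightarrow> ('a \<rightharpoonup> 'a) \<Rightarrow> ('a \<rightharpoonup> 'a)" where
  "pmult \<alpha> \<beta> = \<beta> \<circ>\<^sub>m \<alpha>"

definition semigroup_on :: "'b set \<Rightarrow> ('b \<Rightarrow> 'b \<Rightarrow> 'b) \<Rightarrow> bool" where
  "semigroup_on S m \<longleftrightarrow>
     (\<forall>x\<in>S. \<forall>y\<in>S. m x y \<in> S) \<and>
     (\<forall>x\<in>S. \<forall>y\<in>S. \<forall>z\<in>S. m (m x y) z = m x (m y z))"

definition semitopological_semigroup :: "'b topology \<Rightarrow> ('b \<Rightarrow> 'b \<Rightarrow> 'b) \<Rightarrow> bool" where
  "semitopological_semigroup X m \<longleftrightarrow>
     semigroup_on (topspace X) m \<and>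
     (\<forall>a\<in>topspace X. continuous_map X X (\<lambda>x. m a x) \<and> continuous_map X X (\<lambda>x. m x a))"

definition omega_bounded_pracompact_space :: "'b topology \<Rightarrow> bool" where
  "omega_bounded_pracompact_space X \<longleftrightarrow>
     (\<exists>D\<subseteq>topspace X. X closure_of D = topspace X \<and>
        (\<forall>C\<subseteq>D. countable C \<longrightarrow> compactin X (X closure_of C)))"

definition feebly_omega_bounded_space :: "'b topology \<Rightarrow> bool" where
  "feebly_omega_bounded_space X \<longleftrightarrow>
     (\<forall>U :: nat \<Rightarrow> 'b set. (\<forall>k. openin X (U k) \<and> U k \<noteq> {}) \<longrightarrow>
        (\<exists>K. compactin X K \<and> (\<forall>k. K \<inter> U k \<noteq> {})))"

lemma semigroup_on_partial_injections_rank_le: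
  "semigroup_on (partial_injections_rank_le \<Lambda> n) pmult"
proof -
  have closed: "pmult \<alpha> \<beta> \<in> partial_injections_rank_le \<Lambda> n"
    if a: "\<alpha> \<in> partial_injections_rank_le \<Lambda> n" and b: "\<beta> \<in> partial_injections_rank_le \<Lambda> n"
    for \<alpha> \<beta> :: "'a \<rightharpoonup> 'a"
  proof -
    have sub: "dom (pmult \<alpha> \<beta>) \<subseteq> dom \<alpha>"
      by (auto simp: pmult_def map_comp_Some_iff)
    have fin: "finite (dom \<alpha>)" and le: "card (dom \<alpha>) \<le> n" and "dom \<alpha> \<subseteq> \<Lambda>"
      and inja: "inj_on \<alpha> (dom \<alpha>)"
      using a by (auto simp: partial_injections_rank_le_def partial_injections_def)
    have ranb: "ran \<beta> \<subseteq> \<Lambda>" and injb: "inj_on \<beta> (dom \<beta>)"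
      using b by (auto simp: partial_injections_rank_le_def partial_injections_def)
    have "ran (pmult \<alpha> \<beta>) \<subseteq> ran \<beta>"
      by (auto simp: pmult_def ran_def map_comp_Some_iff)
    moreover have "inj_on (pmult \<alpha> \<beta>) (dom (pmult \<alpha> \<beta>))"
    proof (rule inj_onI)
      fix x y assume "x \<in> dom (pmult \<alpha> \<beta>)" and eq: "pmult \<alpha> \<beta> x = pmult \<alpha> \<beta> y"
      then obtain z where z: "pmult \<alpha> \<beta> x = Some z" by blast
      have z': "pmult \<alpha> \<beta> y = Some z"
        using eq z by (rule trans[OF sym])
      from z obtain u where u: "\<alpha> x = Some u" "\<beta> u = Some z"
        by (auto simp: pmult_def map_comp_Some_iff)
      from z' obtain v where v: "\<alpha> y = Some v" "\<beta> v = Some z"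
        by (auto simp: pmult_def map_comp_Some_iff)
      have "u = v" using inj_onD[OF injb, of u v] u v by (simp add: domI)
      then show "x = y" using inj_onD[OF inja, of x y] u v by (simp add: domI)
    qed
    moreover have "finite (dom (pmult \<alpha> \<beta>))"
      using sub fin by (rule finite_subset)
    moreover have "card (dom (pmult \<alpha> \<beta>)) \<le> n"
      using card_mono[OF fin sub] le by (rule order_trans)
    moreover have "dom (pmult \<alpha> \<beta>) \<subseteq> \<Lambda>"
      using sub \<open>dom \<alpha> \<subseteq> \<Lambda>\<close> by (rule subset_trans)
    ultimately show ?thesis
      using ranb by (simp add: partial_injections_rank_le_def partial_injections_def)
  qed
  have "pmult (pmult \<alpha> \<beta>) \<gamma> = pmult \<alpha> (pmult \<beta> \<gamma>)" for \<alpha> \<beta> \<gamma> :: "'a \<rightharpoonup> 'a"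
    by (rule ext) (simp add: pmult_def map_comp_def split: option.split)
  with closed show ?thesis by (simp add: semigroup_on_def)
qed

end

theory Submission
  imports Defs
begin

text \<open>
  Restricting \<open>\<beta>\<close> to \<open>dom \<alpha>\<close> and corestricting it to \<open>ran \<alpha>\<close> is a continuous map into a finite, hence
  discrete, subspace, so every cone \<open>{\<beta>. \<alpha> \<subseteq>\<^sub>m \<beta>}\<close> is clopen; in particular the elements of rank \<open>n\<close> are
  isolated. A compact set that contains elements above \<open>\<alpha>\<close> missing any prescribed finite set of
  pairs outside \<open>\<alpha>\<close> must contain \<open>\<alpha>\<close>, and \<open>\<alpha>\<close> then lies in the closure of these elements.
  Feeble \<open>\<omega>\<close>-boundedness puts countably many isolated points into one compact set, and by the previous
  remark it then puts every countable set into a compact set. So if \<open>W\<close> is a neighbourhood of \<open>\<alpha>\<close>, the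
  elements above \<open>\<alpha>\<close> outside \<open>W\<close> all meet a fixed finite set of pairs outside \<open>\<alpha>\<close>; they are thus
  covered by finitely many cones over elements of larger rank, and the cones are compact by downward
  induction on the rank.
\<close>

section \<open>Partial injections of bounded rank and their extensions\<close>

lemma map_le_iff_graph_subset: "f \<subseteq>\<^sub>m g \<longleftrightarrow> Map.graph f \<subseteq> Map.graph g"
  by (fastforce simp: map_le_def Map.graph_def dom_def)

lemma finite_partial_maps:
  assumes "finite A" "finite B"
  shows "finite {m. dom m \<subseteq> A \<and> ran m \<subseteq> B}"
proof -
  have "{m. dom m \<subseteq> A \<and> ran m \<subseteq> B} = (\<Union>C\<in>Pow A. {m. dom m = C \<and> ran m \<subseteq> B})"
    by auto
  then show ?thesis
    using assms by (auto intro!: finite_set_of_finite_maps intro: finite_subset)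
qed

lemma partial_injections_rank_leI:
  assumes "dom \<alpha> \<subseteq> \<Lambda>" "ran \<alpha> \<subseteq> \<Lambda>" "inj_on \<alpha> (dom \<alpha>)" "finite (dom \<alpha>)" "card (dom \<alpha>) \<le> n"
  shows "\<alpha> \<in> partial_injections_rank_le \<Lambda> n"
  using assms by (simp add: partial_injections_rank_le_def partial_injections_def)

lemma partial_injections_rank_leD:
  assumes "\<alpha> \<in> partial_injections_rank_le \<Lambda> n"
  shows "dom \<alpha> \<subseteq> \<Lambda>" "ran \<alpha> \<subseteq> \<Lambda>" "inj_on \<alpha> (dom \<alpha>)" "finite (dom \<alpha>)" "card (dom \<alpha>) \<le> n"
    "finite (ran \<alpha>)" "card (ran \<alpha>) \<le> n"
proof -
  show *: "dom \<alpha> \<subseteq> \<Lambda>" "ran \<alpha> \<subseteq> \<Lambda>" "inj_on \<alpha> (dom \<alpha>)" "finite (dom \<alpha>)" "card (dom \<alpha>) \<le> n"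
    using assms by (simp_all add: partial_injections_rank_le_def partial_injections_def)
  have "ran \<alpha> = (\<lambda>x. the (\<alpha> x)) ` dom \<alpha>"
    by (force simp: ran_def)
  then show "finite (ran \<alpha>)" "card (ran \<alpha>) \<le> n"
    using * card_image_le[of "dom \<alpha>" "\<lambda>x. the (\<alpha> x)"] by auto
qed

lemma partial_injections_rank_le_mono:
  assumes "\<alpha> \<subseteq>\<^sub>m \<beta>" and b: "\<beta> \<in> partial_injections_rank_le \<Lambda> n"
  shows "\<alpha> \<in> partial_injections_rank_le \<Lambda> n"
proof (rule partial_injections_rank_leI)
  note D = partial_injections_rank_leD[OF b]
  have sub: "dom \<alpha> \<subseteq> dom \<beta>"
    using assms(1) by (rule map_le_implies_dom_le)
  have eq: "\<alpha> x = \<beta> x" if "x \<in> dom \<alpha>" for x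
    using assms(1) that by (auto simp: map_le_def)
  show "dom \<alpha> \<subseteq> \<Lambda>" "finite (dom \<alpha>)"
    using sub D finite_subset by auto
  have "ran \<alpha> \<subseteq> ran \<beta>"
    using eq by (force simp: ran_def)
  then show "ran \<alpha> \<subseteq> \<Lambda>"
    using D by auto
  show "inj_on \<alpha> (dom \<alpha>)"
  proof (rule inj_onI)
    fix x y assume "x \<in> dom \<alpha>" "y \<in> dom \<alpha>" "\<alpha> x = \<alpha> y"
    then show "x = y"
      using eq sub by (intro inj_onD[OF D(3)]) auto
  qed
  show "card (dom \<alpha>) \<le> n"
    using card_mono[OF D(4) sub] D(5) by simp
qed

lemma restrict_Some_in_partial_injections_rank_le:
  assumes "A \<subseteq> \<Lambda>" "finite A" "card A \<le> n"
  shows "Some |` A \<in> partial_injections_rank_le \<Lambda> n"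
proof -
  have "dom (Some |` A) = A" "ran (Some |` A) \<subseteq> A"
    by (auto simp: restrict_map_def ran_def split: if_splits)
  with assms show ?thesis
    by (intro partial_injections_rank_leI) (auto simp: inj_on_def)
qed

text \<open>Adjoin the identity on fresh points of the infinite set \<open>\<Lambda>\<close>.
  Keeping these points off \<open>ran \<alpha>\<close> preserves injectivity; keeping them off
  \<open>G\<close> will help to avoid prescribed pairs.\<close>

lemma ex_full_rank_extension:
  assumes "infinite \<Lambda>" "\<alpha> \<in> partial_injections_rank_le \<Lambda> n" "finite G"
  obtains \<beta> where "\<beta> \<in> partial_injections_rank_le \<Lambda> n" "card (dom \<beta>) = n" "\<alpha> \<subseteq>\<^sub>m \<beta>"
    "dom \<beta> \<inter> G \<subseteq> dom \<alpha>"
proof -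
  note D = partial_injections_rank_leD[OF assms(2)]
  have "infinite (\<Lambda> - (G \<union> dom \<alpha> \<union> ran \<alpha>))"
    using assms D by (simp add: Diff_infinite_finite)
  then obtain A where A: "A \<subseteq> \<Lambda> - (G \<union> dom \<alpha> \<union> ran \<alpha>)" "finite A" "card A = n - card (dom \<alpha>)"
    by (metis infinite_arbitrarily_large)
  define \<beta> where "\<beta> = \<alpha> ++ Some |` A"
  have app: "\<beta> x = (if x \<in> A then Some x else \<alpha> x)" for x
    by (simp add: \<beta>_def map_add_def restrict_map_def)
  have dom: "dom \<beta> = dom \<alpha> \<union> A"
    by (auto simp: app split: if_splits)
  show thesis
  proof
    show card: "card (dom \<beta>) = n"
      using A D by (subst dom, subst card_Un_disjoint) auto
    show "\<beta> \<in> partial_injections_rank_le \<Lambda> n"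
    proof (rule partial_injections_rank_leI)
      show "ran \<beta> \<subseteq> \<Lambda>"
        using A D by (auto simp: ran_def app split: if_splits)
      show "inj_on \<beta> (dom \<beta>)"
      proof (rule inj_onI)
        fix x y assume "x \<in> dom \<beta>" "y \<in> dom \<beta>" "\<beta> x = \<beta> y"
        moreover have "\<alpha> u \<noteq> Some v" "Some v \<noteq> \<alpha> u" if "v \<in> A" for u v
          using A(1) that ranI[of \<alpha> u v] by auto
        ultimately show "x = y"
          using D(3) by (auto simp: app dom inj_on_def split: if_splits)
      qed
    qed (use A D dom card in auto)
    show "\<alpha> \<subseteq>\<^sub>m \<beta>"
      using A by (auto simp: map_le_def app)
    show "dom \<beta> \<inter> G \<subseteq> dom \<alpha>"
      using A dom by auto
  qed
qed

section \<open>Combinatorial accumulation at a partial map\<close>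

text \<open>A topology-free substitute for lying in the closure of \<open>S\<close>: the finite set
  \<open>F\<close> plays the part of a basic neighbourhood, and only elements above
  \<open>\<alpha>\<close> count.\<close>

definition accumulates :: "('a \<rightharpoonup> 'b) set \<Rightarrow> ('a \<rightharpoonup> 'b) \<Rightarrow> bool" where
  "accumulates S \<alpha> \<longleftrightarrow>
     (\<forall>F. finite F \<longrightarrow> F \<inter> Map.graph \<alpha> = {} \<longrightarrow> (\<exists>z\<in>S. \<alpha> \<subseteq>\<^sub>m z \<and> Map.graph z \<inter> F = {}))"

lemma accumulatesD:
  assumes "accumulates S \<alpha>" "finite F" "F \<inter> Map.graph \<alpha> = {}"
  obtains z where "z \<in> S" "\<alpha> \<subseteq>\<^sub>m z" "Map.graph z \<inter> F = {}"
  using assms unfolding accumulates_def by blast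

text \<open>Elements above \<open>\<alpha>\<close> are chosen greedily so that the pairs they add to
  \<open>\<alpha>\<close> are pairwise disjoint; a finite \<open>F\<close> then meets the added
  pairs of only finitely many of them. Finiteness of the graphs keeps the set to be avoided finite
  at every stage.\<close>

lemma accumulates_countable_subset:
  assumes acc: "accumulates S \<alpha>" and fin: "\<And>z. z \<in> S \<Longrightarrow> finite (Map.graph z)"
  obtains T where "T \<subseteq> S" "countable T" "accumulates T \<alpha>"
proof -
  define g where "g z = Map.graph z - Map.graph \<alpha>" for z
  define P where "P F z \<longleftrightarrow> z \<in> S \<and> \<alpha> \<subseteq>\<^sub>m z \<and> g z \<inter> F = {}" for F z
  define c where "c F = (SOME z. P F z)" for F
  have "\<exists>z. P F z" if "finite F" for F
  proof -
    obtain z where "z \<in> S" "\<alpha> \<subseteq>\<^sub>m z" "Map.graph z \<inter> (F - Map.graph \<alpha>) = {}"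
      using accumulatesD[OF acc, of "F - Map.graph \<alpha>"] \<open>finite F\<close> by blast
    then have "P F z"
      by (auto simp: P_def g_def)
    then show ?thesis
      by (rule exI[of _ z])
  qed
  then have c: "P F (c F)" if "finite F" for F
    unfolding c_def using that by (intro someI_ex[of "P F"])
  \<comment> \<open>\<open>Fs k\<close> collects the pairs added by the first \<open>k\<close>
    choices, starting from the empty set; the next choice has to avoid them.\<close>
  define Fs where "Fs = rec_nat {} (\<lambda>_ F. F \<union> g (c F))"
  have Fs_Suc: "Fs (Suc k) = Fs k \<union> g (c (Fs k))" for k
    by (simp add: Fs_def)
  have finFs: "finite (Fs k)" for k
  proof (induction k)
    case 0 then show ?case by (simp add: Fs_def)
  next
    case (Suc k)
    then show ?case
      using c[OF Suc] fin by (simp add: Fs_Suc P_def g_def)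
  qed
  define z where "z k = c (Fs k)" for k
  have z: "z k \<in> S" "\<alpha> \<subseteq>\<^sub>m z k" "g (z k) \<inter> Fs k = {}" for k
    using c[OF finFs[of k]] by (auto simp: P_def z_def)
  have "mono Fs"
    by (rule incseq_SucI) (auto simp: Fs_Suc)
  have disj: "g (z i) \<inter> g (z j) = {}" if "i < j" for i j
  proof -
    have "g (z i) \<subseteq> Fs (Suc i)"
      by (simp add: Fs_Suc z_def)
    also have "\<dots> \<subseteq> Fs j"
      using monoD[OF \<open>mono Fs\<close>, of "Suc i" j] that by simp
    finally show ?thesis
      using z(3)[of j] by blast
  qed
  have "accumulates (range z) \<alpha>"
    unfolding accumulates_def
  proof (intro allI impI)
    fix F assume F: "finite F" "F \<inter> Map.graph \<alpha> = {}"
    \<comment> \<open>Otherwise picking one point of \<open>F\<close> from each of the disjoint sets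
      \<open>g (z k)\<close> would embed the natural numbers into \<open>F\<close>.\<close>
    have "\<exists>k. g (z k) \<inter> F = {}"
    proof (rule ccontr)
      assume "\<nexists>k. g (z k) \<inter> F = {}"
      then have "\<forall>k. \<exists>p. p \<in> g (z k) \<inter> F" by blast
      then obtain h where h: "\<And>k. h k \<in> g (z k) \<inter> F" by metis
      have "h i \<noteq> h j" if "i < j" for i j
        using disj[OF that] h[of i] h[of j] by auto
      then have "inj h"
        by (metis injI linorder_neqE_nat)
      moreover have "range h \<subseteq> F"
        using h by blast
      ultimately show False
        using F(1) by (metis finite_imageD finite_subset infinite_UNIV_nat)
    qed
    then show "\<exists>z\<in>range z. \<alpha> \<subseteq>\<^sub>m z \<and> Map.graph z \<inter> F = {}"
      using F z(2) unfolding g_def by blast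
  qed
  moreover have "range z \<subseteq> S" "countable (range z)"
    using z(1) by auto
  ultimately show thesis
    using that by blast
qed

text \<open>Extend \<open>\<alpha>\<close> to rank \<open>n\<close> by points that are not first
  coordinates in \<open>F\<close>. A pair of the extension lying in \<open>F\<close> would then
  already belong to \<open>\<alpha>\<close>, which \<open>F\<close> avoids.\<close>

lemma accumulates_full_rank:
  assumes "infinite \<Lambda>" "\<alpha> \<in> partial_injections_rank_le \<Lambda> n"
  shows "accumulates {\<beta> \<in> partial_injections_rank_le \<Lambda> n. card (dom \<beta>) = n} \<alpha>"
  unfolding accumulates_def
proof (intro allI impI)
  fix F :: "('a \<times> 'a) set" assume F: "finite F" "F \<inter> Map.graph \<alpha> = {}"
  obtain \<beta> where \<beta>: "\<beta> \<in> partial_injections_rank_le \<Lambda> n" "card (dom \<beta>) = n" "\<alpha> \<subseteq>\<^sub>m \<beta>"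
    "dom \<beta> \<inter> fst ` F \<subseteq> dom \<alpha>"
    using ex_full_rank_extension[OF assms, of "fst ` F"] F(1) by blast
  have "p \<notin> F" if "p \<in> Map.graph \<beta>" for p
  proof
    assume "p \<in> F"
    have "\<beta> (fst p) = Some (snd p)"
      using that by (auto simp: Map.graph_def)
    moreover from this have "fst p \<in> dom \<alpha>"
      using \<beta>(4) \<open>p \<in> F\<close> by blast
    ultimately have "p \<in> Map.graph \<alpha>"
      using \<beta>(3) by (cases p) (auto simp: map_le_def Map.graph_def)
    with F(2) \<open>p \<in> F\<close> show False by blast
  qed
  with \<beta> show "\<exists>z\<in>{\<beta> \<in> partial_injections_rank_le \<Lambda> n. card (dom \<beta>) = n}.
      \<alpha> \<subseteq>\<^sub>m z \<and> Map.graph z \<inter> F = {}"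
    by blast
qed

section \<open>Cones in a T1 semitopological topology\<close>

locale t1_semitopological_partial_injections =
  fixes \<Lambda> :: "'a set" and n :: nat and \<tau> :: "('a \<rightharpoonup> 'a) topology"
  assumes infinite_base: "infinite \<Lambda>"
    and topspace_eq: "topspace \<tau> = partial_injections_rank_le \<Lambda> n"
    and t1: "t1_space \<tau>"
    and semitop: "semitopological_semigroup \<tau> pmult"
begin

definition up :: "('a \<rightharpoonup> 'a) \<Rightarrow> ('a \<rightharpoonup> 'a) set" where
  "up \<alpha> = {\<beta> \<in> topspace \<tau>. \<alpha> \<subseteq>\<^sub>m \<beta>}"

lemma in_topspaceD:
  assumes "\<alpha> \<in> topspace \<tau>"
  shows "dom \<alpha> \<subseteq> \<Lambda>" "ran \<alpha> \<subseteq> \<Lambda>" "finite (dom \<alpha>)" "card (dom \<alpha>) \<le> n" "finite (ran \<alpha>)"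
    "card (ran \<alpha>) \<le> n"
  using partial_injections_rank_leD[of \<alpha> \<Lambda> n] assms by (auto simp: topspace_eq)

lemma clopen_up:
  assumes \<alpha>: "\<alpha> \<in> topspace \<tau>"
  shows "openin \<tau> (up \<alpha>)" "closedin \<tau> (up \<alpha>)"
proof -
  note D = in_topspaceD[OF \<alpha>]
  \<comment> \<open>The factors are partial identities: the left one restricts to
    \<open>dom \<alpha>\<close>, the right one corestricts to \<open>ran \<alpha>\<close>. As a
    composite of two translations, \<open>f\<close> is continuous by separate continuity
    alone.\<close>
  define f where "f = (\<lambda>\<beta>. pmult (pmult (Some |` dom \<alpha>) \<beta>) (Some |` ran \<alpha>))"
  have mem: "Some |` dom \<alpha> \<in> topspace \<tau>" "Some |` ran \<alpha> \<in> topspace \<tau>"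
    using D by (auto simp: topspace_eq intro!: restrict_Some_in_partial_injections_rank_le)
  have "continuous_map \<tau> \<tau> (\<lambda>\<beta>. pmult (Some |` dom \<alpha>) \<beta>)"
    "continuous_map \<tau> \<tau> (\<lambda>\<beta>. pmult \<beta> (Some |` ran \<alpha>))"
    using semitop mem unfolding semitopological_semigroup_def by blast+
  from continuous_map_compose[OF this] have cont: "continuous_map \<tau> \<tau> f"
    by (simp add: f_def o_def)
  have app: "f \<beta> x = Some y \<longleftrightarrow> x \<in> dom \<alpha> \<and> \<beta> x = Some y \<and> y \<in> ran \<alpha>" for \<beta> x y
    by (auto simp: f_def pmult_def map_comp_Some_iff restrict_map_def split: if_splits)
  have f_eq: "f \<beta> = \<alpha> \<longleftrightarrow> \<alpha> \<subseteq>\<^sub>m \<beta>" for \<beta>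
  proof
    assume "f \<beta> = \<alpha>"
    then show "\<alpha> \<subseteq>\<^sub>m \<beta>"
      using app[of \<beta>] by (auto simp: map_le_def)
  next
    assume le: "\<alpha> \<subseteq>\<^sub>m \<beta>"
    have "f \<beta> x = Some y \<longleftrightarrow> \<alpha> x = Some y" for x y
      using le by (force simp: app map_le_def ran_def)
    then show "f \<beta> = \<alpha>"
      by (metis ext not_Some_eq)
  qed
  \<comment> \<open>\<open>R\<close> contains every value of \<open>f\<close> on the space other
    than \<open>\<alpha>\<close>. Being finite it is closed by T1, so the preimage of its
    complement, which is the cone, is open.\<close>
  define R where "R = {m \<in> topspace \<tau>. dom m \<subseteq> dom \<alpha> \<and> ran m \<subseteq> ran \<alpha>} - {\<alpha>}"
  have "finite R"
    using finite_partial_maps[of "dom \<alpha>" "ran \<alpha>"] D by (auto simp: R_def intro: rev_finite_subset)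
  then have "closedin \<tau> R"
    using t1 by (auto simp: t1_space_closedin_finite R_def)
  then have "openin \<tau> {\<beta> \<in> topspace \<tau>. f \<beta> \<in> topspace \<tau> - R}"
    using cont by (intro openin_continuous_map_preimage) auto
  also have "{\<beta> \<in> topspace \<tau>. f \<beta> \<in> topspace \<tau> - R} = up \<alpha>"
  proof -
    have "f \<beta> \<in> topspace \<tau> - R \<longleftrightarrow> \<alpha> \<subseteq>\<^sub>m \<beta>" if "\<beta> \<in> topspace \<tau>" for \<beta>
    proof -
      have "f \<beta> \<in> topspace \<tau>"
        using cont that by (auto simp: continuous_map_def)
      moreover have "dom (f \<beta>) \<subseteq> dom \<alpha>" "ran (f \<beta>) \<subseteq> ran \<alpha>"
        using app[of \<beta>] by (auto simp: ran_def)
      ultimately show ?thesis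
        by (auto simp: R_def simp flip: f_eq)
    qed
    then show ?thesis by (auto simp: up_def)
  qed
  finally show "openin \<tau> (up \<alpha>)" .
  have "closedin \<tau> {\<alpha>}"
    using t1 \<alpha> by (simp add: t1_space_closedin_singleton)
  with cont have "closedin \<tau> {\<beta> \<in> topspace \<tau>. f \<beta> \<in> {\<alpha>}}"
    by (rule closedin_continuous_map_preimage)
  then show "closedin \<tau> (up \<alpha>)"
    by (simp add: f_eq up_def)
qed

text \<open>An extension of a map of rank \<open>n\<close> has no room for a larger domain. Together
  with \<open>clopen_up\<close> this makes the elements of rank \<open>n\<close> isolated.\<close>

lemma up_full_rank:
  assumes \<alpha>: "\<alpha> \<in> topspace \<tau>" and rank: "card (dom \<alpha>) = n"
  shows "up \<alpha> = {\<alpha>}"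
proof -
  have "\<beta> = \<alpha>" if "\<beta> \<in> topspace \<tau>" and le: "\<alpha> \<subseteq>\<^sub>m \<beta>" for \<beta>
  proof -
    have "dom \<alpha> = dom \<beta>"
      using card_seteq[of "dom \<beta>" "dom \<alpha>"] in_topspaceD[OF that(1)] rank
        map_le_implies_dom_le[OF le] by auto
    then have "\<beta> \<subseteq>\<^sub>m \<alpha>"
      using le by (simp add: map_le_def)
    then show ?thesis
      using le by (rule map_le_antisym)
  qed
  with \<alpha> show ?thesis by (auto simp: up_def)
qed

text \<open>Stated so that \<open>W = {}\<close> yields \<open>\<alpha> \<in> K\<close>.\<close>

lemma compactin_accumulates:
  assumes K: "compactin \<tau> K" and S: "S \<subseteq> K" and \<alpha>: "\<alpha> \<in> topspace \<tau>" and acc: "accumulates S \<alpha>"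
    and W: "openin \<tau> W" and \<alpha>W: "\<alpha> \<in> K \<Longrightarrow> \<alpha> \<in> W"
  shows "S \<inter> W \<noteq> {}"
proof
  assume SW: "S \<inter> W = {}"
  have Ksub: "K \<subseteq> topspace \<tau>"
    using K by (rule compactin_subset_topspace)
  let ?L = "up \<alpha> \<inter> K"
  have L: "compactin \<tau> ?L"
    using closed_Int_compactin[OF clopen_up(2)[OF \<alpha>] K] .
  \<comment> \<open>Every element of \<open>?L\<close> other than \<open>\<alpha>\<close> is covered
    by its own cone, and \<open>\<alpha>\<close>, if present, by \<open>W\<close>.\<close>
  have "?L \<subseteq> \<Union>(insert W (up ` (?L - {\<alpha>})))"
    using \<alpha>W Ksub by (auto simp: up_def)
  moreover have "openin \<tau> U" if "U \<in> insert W (up ` (?L - {\<alpha>}))" for U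
    using that W clopen_up(1) Ksub by auto
  ultimately obtain \<F> where \<F>: "finite \<F>" "\<F> \<subseteq> insert W (up ` (?L - {\<alpha>}))" "?L \<subseteq> \<Union>\<F>"
    using compactinD[OF L] by metis
  have "finite (\<F> - {W})" "\<F> - {W} \<subseteq> up ` (?L - {\<alpha>})"
    using \<F> by auto
  then obtain C where C: "finite C" "C \<subseteq> ?L - {\<alpha>}" "\<F> - {W} = up ` C"
    by (metis finite_subset_image)
  have "\<exists>p. p \<in> Map.graph c \<and> p \<notin> Map.graph \<alpha>" if "c \<in> C" for c
  proof -
    have "\<alpha> \<subseteq>\<^sub>m c" "c \<noteq> \<alpha>"
      using C that by (auto simp: up_def)
    then have "\<not> c \<subseteq>\<^sub>m \<alpha>"
      using map_le_antisym by blast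
    then show ?thesis
      by (auto simp: map_le_iff_graph_subset)
  qed
  then obtain p where p: "\<And>c. c \<in> C \<Longrightarrow> p c \<in> Map.graph c \<and> p c \<notin> Map.graph \<alpha>"
    by metis
  \<comment> \<open>One pair outside \<open>\<alpha>\<close> from each centre of the finite subcover
    is forbidden, so \<open>z\<close> lies in none of these cones; missing \<open>W\<close> as well,
    it escapes the cover.\<close>
  obtain z where z: "z \<in> S" "\<alpha> \<subseteq>\<^sub>m z" "Map.graph z \<inter> p ` C = {}"
    using accumulatesD[OF acc, of "p ` C"] C p by blast
  have "z \<in> ?L"
    using z S Ksub by (auto simp: up_def)
  with \<F>(3) SW z C(3) obtain c where "c \<in> C" "z \<in> up c"
    by blast
  with p[of c] z(3) show False
    by (auto simp: up_def map_le_iff_graph_subset)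
qed

section \<open>From feeble omega-boundedness to compactness\<close>

text \<open>Each point of \<open>Z\<close> is accumulated by countably many elements of rank
  \<open>n\<close>. All of these are isolated, so one compact set captures them, and it must then
  contain \<open>Z\<close>.\<close>

lemma countable_subset_compactin:
  assumes feeb: "feebly_omega_bounded_space \<tau>" and Z: "countable Z" "Z \<subseteq> topspace \<tau>"
  obtains K where "compactin \<tau> K" "Z \<subseteq> K"
proof (cases "Z = {}")
  case True
  then show thesis using that[of "{}"] by simp
next
  case False
  let ?M = "{\<beta> \<in> partial_injections_rank_le \<Lambda> n. card (dom \<beta>) = n}"
  have "\<exists>T\<subseteq>?M. countable T \<and> accumulates T z" if "z \<in> Z" for z
  proof -
    have "accumulates ?M z"
      using accumulates_full_rank[OF infinite_base] Z that by (auto simp: topspace_eq)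
    moreover have "finite (Map.graph y)" if "y \<in> ?M" for y
      using that in_topspaceD(3) by (simp add: topspace_eq)
    ultimately obtain T where "T \<subseteq> ?M" "countable T" "accumulates T z"
      by (rule accumulates_countable_subset)
    then show ?thesis by blast
  qed
  then obtain T where T: "\<And>z. z \<in> Z \<Longrightarrow> T z \<subseteq> ?M \<and> countable (T z) \<and> accumulates (T z) z"
    by metis
  define Y where "Y = (\<Union>z\<in>Z. T z)"
  have "countable Y" "Y \<subseteq> ?M"
    using Z T by (auto simp: Y_def)
  \<comment> \<open>The case \<open>F = {}\<close> of accumulation gives an element of
    \<open>T z\<close>; nonemptiness is needed to enumerate \<open>Y\<close> by
    \<open>from_nat_into\<close>.\<close>
  have "Y \<noteq> {}"
    using False T by (force simp: Y_def accumulates_def)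
  have rangeY: "range (from_nat_into Y) = Y"
    using \<open>Y \<noteq> {}\<close> \<open>countable Y\<close> by (rule range_from_nat_into)
  have "openin \<tau> {from_nat_into Y k}" for k
  proof -
    have "from_nat_into Y k \<in> ?M"
      using from_nat_into[OF \<open>Y \<noteq> {}\<close>] \<open>Y \<subseteq> ?M\<close> by blast
    then show ?thesis
      using clopen_up(1)[of "from_nat_into Y k"] up_full_rank[of "from_nat_into Y k"]
      by (simp add: topspace_eq)
  qed
  with feeb obtain K where K: "compactin \<tau> K" "\<And>k. K \<inter> {from_nat_into Y k} \<noteq> {}"
    unfolding feebly_omega_bounded_space_def
    by (elim allE[of _ "\<lambda>k. {from_nat_into Y k}"]) auto
  have "Y \<subseteq> K"
    using K(2) by (subst rangeY[symmetric]) auto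
  have "Z \<subseteq> K"
  proof
    fix z assume "z \<in> Z"
    show "z \<in> K"
    proof (rule ccontr)
      assume "z \<notin> K"
      moreover have "T z \<subseteq> K"
        using \<open>Y \<subseteq> K\<close> \<open>z \<in> Z\<close> by (auto simp: Y_def)
      ultimately have "T z \<inter> {} \<noteq> {}"
        using K(1) T[OF \<open>z \<in> Z\<close>] Z \<open>z \<in> Z\<close> by (intro compactin_accumulates) auto
      then show False by simp
    qed
  qed
  with K(1) show thesis by (rule that)
qed

lemma compactin_up:
  assumes feeb: "feebly_omega_bounded_space \<tau>" and "\<alpha> \<in> topspace \<tau>"
  shows "compactin \<tau> (up \<alpha>)"
  using assms(2)
proof (induction "n - card (dom \<alpha>)" arbitrary: \<alpha> rule: less_induct)
  case (less \<alpha>)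
  note \<alpha> = \<open>\<alpha> \<in> topspace \<tau>\<close>
  show ?case
    unfolding compactin_def
  proof (intro conjI allI impI)
    show "up \<alpha> \<subseteq> topspace \<tau>"
      by (auto simp: up_def)
    fix \<U> assume \<U>: "Ball \<U> (openin \<tau>) \<and> up \<alpha> \<subseteq> \<Union>\<U>"
    have "\<alpha> \<in> up \<alpha>"
      using \<alpha> by (simp add: up_def)
    with \<U> obtain W where W: "W \<in> \<U>" "\<alpha> \<in> W" "openin \<tau> W"
      by blast
    \<comment> \<open>A countable part outside \<open>W\<close> accumulating at
      \<open>\<alpha>\<close> would lie in a compact set and hence be forced to meet
      \<open>W\<close>.\<close>
    have "\<not> accumulates (up \<alpha> - W) \<alpha>"
    proof
      assume "accumulates (up \<alpha> - W) \<alpha>"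
      moreover have "finite (Map.graph z)" if "z \<in> up \<alpha> - W" for z
        using that in_topspaceD(3) by (simp add: up_def)
      ultimately obtain T where T: "T \<subseteq> up \<alpha> - W" "countable T" "accumulates T \<alpha>"
        by (rule accumulates_countable_subset)
      moreover have "T \<subseteq> topspace \<tau>"
        using T(1) by (auto simp: up_def)
      ultimately obtain K where "compactin \<tau> K" "T \<subseteq> K"
        using countable_subset_compactin[OF feeb] by metis
      then have "T \<inter> W \<noteq> {}"
        using \<alpha> T W by (intro compactin_accumulates)
      with T(1) show False by blast
    qed
    then obtain F where F: "finite F" "F \<inter> Map.graph \<alpha> = {}"
      and meet: "\<And>z. z \<in> up \<alpha> - W \<Longrightarrow> Map.graph z \<inter> F \<noteq> {}"
      unfolding accumulates_def up_def by blast
    define ext where "ext p = \<alpha>(fst p \<mapsto> snd p)" for p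
    \<comment> \<open>These are the pairs of \<open>F\<close> that extend \<open>\<alpha>\<close>
      properly within the semigroup. The set is empty when \<open>\<alpha>\<close> has rank
      \<open>n\<close>, so the induction needs no separate base case.\<close>
    define F' where "F' = {p \<in> F. fst p \<notin> dom \<alpha> \<and> ext p \<in> topspace \<tau>}"
    have cover: "up \<alpha> - W \<subseteq> (\<Union>p\<in>F'. up (ext p))"
    proof
      fix z assume z: "z \<in> up \<alpha> - W"
      obtain x y where p: "(x, y) \<in> F" "z x = Some y"
        using meet[OF z] by (auto simp: Map.graph_def)
      have le: "\<alpha> \<subseteq>\<^sub>m z" and zX: "z \<in> topspace \<tau>"
        using z by (auto simp: up_def)
      have "\<alpha> x \<noteq> Some y"
        using F(2) p(1) by (auto simp: Map.graph_def)
      with le p(2) have x: "x \<notin> dom \<alpha>"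
        by (metis map_le_def)
      have le': "ext (x, y) \<subseteq>\<^sub>m z"
        using le p(2) by (simp add: ext_def map_le_def)
      with zX have "ext (x, y) \<in> topspace \<tau>"
        using partial_injections_rank_le_mono by (auto simp: topspace_eq)
      with p x have "(x, y) \<in> F'"
        by (simp add: F'_def)
      with le' zX show "z \<in> (\<Union>p\<in>F'. up (ext p))"
        by (auto simp: up_def)
    qed
    have "compactin \<tau> (up (ext p))" if "p \<in> F'" for p
    proof (rule less.hyps)
      show X: "ext p \<in> topspace \<tau>"
        using that by (simp add: F'_def)
      have "card (dom (ext p)) = Suc (card (dom \<alpha>))"
        using that in_topspaceD(3)[OF \<alpha>] by (simp add: ext_def F'_def)
      \<comment> \<open>The new rank is still at most \<open>n\<close>, so the truncated difference
        really drops.\<close>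
      then show "n - card (dom (ext p)) < n - card (dom \<alpha>)"
        using in_topspaceD(4)[OF X] by simp
    qed
    then have "compactin \<tau> (\<Union>p\<in>F'. up (ext p))"
      using F(1) by (intro compactin_Union) (auto simp: F'_def)
    moreover have "closedin \<tau> (up \<alpha> - W)"
      using clopen_up(2)[OF \<alpha>] W(3) by (rule closedin_diff)
    ultimately have "compactin \<tau> (up \<alpha> - W)"
      by (rule closed_compactin[OF _ cover])
    moreover have "up \<alpha> - W \<subseteq> \<Union>\<U>"
      using \<U> by blast
    ultimately obtain \<F> where "finite \<F>" "\<F> \<subseteq> \<U>" "up \<alpha> - W \<subseteq> \<Union>\<F>"
      using \<U> compactinD[of \<tau> "up \<alpha> - W" \<U>] by metis
    with W(1) show "\<exists>\<F>. finite \<F> \<and> \<F> \<subseteq> \<U> \<and> up \<alpha> \<subseteq> \<Union>\<F>"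
      by (intro exI[of _ "insert W \<F>"]) auto
  qed
qed

text \<open>The whole space is the cone over the empty map.\<close>

lemma feebly_omega_bounded_imp_compact:
  assumes "feebly_omega_bounded_space \<tau>"
  shows "compact_space \<tau>"
proof -
  have "Map.empty \<in> topspace \<tau>"
    by (simp add: topspace_eq partial_injections_rank_leI)
  then have "compactin \<tau> (up Map.empty)"
    by (rule compactin_up[OF assms])
  then show ?thesis
    by (simp add: compact_space_def up_def)
qed

end

section \<open>Implications valid in every topological space\<close>

lemma compact_imp_omega_bounded_pracompact:
  assumes "compact_space X"
  shows "omega_bounded_pracompact_space X"
  using assms unfolding omega_bounded_pracompact_space_def
  by (intro exI[of _ "topspace X"]) (auto simp: closedin_compact_space)

text \<open>Choose a point of the dense set in each \<open>U k\<close>; the closure of this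
  countable set is the required compact set.\<close>

lemma omega_bounded_pracompact_imp_feebly_omega_bounded:
  assumes "omega_bounded_pracompact_space X"
  shows "feebly_omega_bounded_space X"
  unfolding feebly_omega_bounded_space_def
proof (intro allI impI)
  fix U :: "nat \<Rightarrow> 'a set" assume U: "\<forall>k. openin X (U k) \<and> U k \<noteq> {}"
  obtain D where D: "D \<subseteq> topspace X" "X closure_of D = topspace X"
    and cpt: "\<And>C. C \<subseteq> D \<Longrightarrow> countable C \<Longrightarrow> compactin X (X closure_of C)"
    using assms unfolding omega_bounded_pracompact_space_def by blast
  have "D \<inter> U k \<noteq> {}" for k
    using U D(2) unfolding dense_intersects_open by simp
  then have "\<exists>d. d \<in> D \<inter> U k" for k
    by blast
  then obtain d where d: "\<And>k. d k \<in> D \<inter> U k"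
    by metis
  then have "range d \<subseteq> X closure_of (range d)"
    using D(1) by (intro closure_of_subset) auto
  moreover have "compactin X (X closure_of (range d))"
    using d by (intro cpt) auto
  ultimately show "\<exists>K. compactin X K \<and> (\<forall>k. K \<inter> U k \<noteq> {})"
    using d by blast
qed

theorem theorem17:
  fixes \<Lambda> :: "'a set" and n :: nat and \<tau> :: "('a \<rightharpoonup> 'a) topology"
  assumes "n > 0"
    and "infinite \<Lambda>"
    and "topspace \<tau> = partial_injections_rank_le \<Lambda> n"
    and "t1_space \<tau>"
    and "semitopological_semigroup \<tau> pmult"
  shows "(compact_space \<tau> \<longleftrightarrow> omega_bounded_pracompact_space \<tau>) \<and>
         (omega_bounded_pracompact_space \<tau> \<longleftrightarrow> feebly_omega_bounded_space \<tau>)"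
proof -
  interpret t1_semitopological_partial_injections \<Lambda> n \<tau>
    using assms by unfold_locales
  show ?thesis
    using compact_imp_omega_bounded_pracompact omega_bounded_pracompact_imp_feebly_omega_bounded
      feebly_omega_bounded_imp_compact by blast
qed

end
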